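(* Let $A,a$ be positive integers. As formal power series in $q$, $$\sum_{n\geq0}\overline{p}_{A,a}(n)q^n=\frac{1}{(q;q)_\infty}\sum_{n\geq0}(-1)^nq^{\frac{An(n+1)}{2}+a(n+1)}.$$
   Context: $(q;q)_\infty=\prod_{k\ge1}(1-q^k)$. A partition of $n$ is a finite multiset of positive integers summing to $n$. For positive integers $A,a$ and a partition $\pi$, $\mathrm{mex}_{A,a}(\pi)$ is the smallest element of $\{a,a+A,a+2A,\dots\}$ that is not a part of $\pi$. $\overline{p}_{A,a}(n)$ is the number of partitions $\pi$ of $n$ with $\mathrm{mex}_{A,a}(\pi)\equiv A+a \pmod{2A}$. *)

theory Defs
  imports "HOL-Analysis.Analysis" "HOL-Number_Theory.Cong"
begin

definition is_partition :: "nat \<Rightarrow> nat multiset \<Rightarrow> bool" where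
  "is_partition n \<pi> \<longleftrightarrow> (\<forall>k\<in>#\<pi>. k > 0) \<and> sum_mset \<pi> = n"

definition mex :: "nat \<Rightarrow> nat \<Rightarrow> nat multiset \<Rightarrow> nat" where
  "mex A a \<pi> = (LEAST m. m \<in> {a + A * j | j. True} \<and> m \<notin># \<pi>)"

definition p_bar :: "nat \<Rightarrow> nat \<Rightarrow> nat \<Rightarrow> nat" where
  "p_bar A a n = card {\<pi>. is_partition n \<pi> \<and> [mex A a \<pi> = A + a] (mod (2 * A))}"

text \<open>
  The product $(q;q)_\infty$, as a limit in the $q$-adic metric on formal power series.
  Since \<^const>\<open>prodinf\<close> starts at index 0, the factor of index \<open>k\<close> is $1 - q^{k+1}$.
\<close>
definition qq_infinity :: "'a :: field fps" where
  "qq_infinity = (\<Prod>k. 1 - fps_X ^ Suc k)"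

text \<open>
  The lemmas below show that nothing above takes a default value: the sets that are counted
  are finite, the minimal excludant exists (for \<open>A > 0\<close>), the infinite product and the series
  in question converge, and $(q;q)_\infty$ is invertible.
\<close>

lemma finite_partitions: "finite {\<pi>. is_partition n \<pi>}"
proof (rule finite_subset)
  show "{\<pi>. is_partition n \<pi>} \<subseteq> mset ` {xs. set xs \<subseteq> {0..n} \<and> length xs \<le> n}"
  proof
    fix \<pi> assume "\<pi> \<in> {\<pi>. is_partition n \<pi>}"
    hence pos: "\<forall>k\<in>#\<pi>. k > 0" and s: "sum_mset \<pi> = n"
      by (auto simp: is_partition_def)
    obtain xs where xs: "\<pi> = mset xs" by (metis ex_mset)
    have *: "length ys \<le> sum_list ys" if "\<forall>k\<in>set ys. k > 0" for ys :: "nat list"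
      using that by (induction ys) auto
    have "length xs \<le> n" using *[of xs] pos s xs by (simp add: sum_mset_sum_list)
    moreover have "set xs \<subseteq> {0..n}"
      using s xs member_le_sum_list by (fastforce simp: sum_mset_sum_list)
    ultimately show "\<pi> \<in> mset ` {xs. set xs \<subseteq> {0..n} \<and> length xs \<le> n}"
      using xs by blast
  qed
  show "finite (mset ` {xs. set xs \<subseteq> {0..n} \<and> length xs \<le> n})"
    by (intro finite_imageI finite_lists_length_le) auto
qed

lemma mex_exists:
  fixes A a :: nat
  assumes "A > 0"
  shows "\<exists>m. m \<in> {a + A * j | j. True} \<and> m \<notin># \<pi>"
proof -
  have "inj (\<lambda>j. a + A * j)"
  proof (rule injI)
    fix x y assume "a + A * x = a + A * y"
    hence "A * x = A * y" by simp
    thus "x = y" using assms by simp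
  qed
  hence "infinite (range (\<lambda>j. a + A * j))" using finite_imageD by blast
  moreover have "range (\<lambda>j. a + A * j) = {a + A * j | j. True}" by auto
  ultimately show ?thesis
    by (metis finite_set_mset finite_subset subsetI)
qed

lemma qq_partial_nth:
  assumes "n \<le> N" "N \<le> M"
  shows "fps_nth (\<Prod>k<M. 1 - fps_X ^ Suc k :: 'a :: field fps) n
       = fps_nth (\<Prod>k<N. 1 - fps_X ^ Suc k) n"
  using assms(2)
proof (induction M rule: dec_induct)
  case (step M)
  have "fps_nth ((\<Prod>k<M. 1 - fps_X ^ Suc k) * fps_X ^ Suc M :: 'a fps) n = 0"
    using step assms by (subst fps_X_power_mult_right_nth) auto
  with step show ?case
    by (simp only: prod.lessThan_Suc right_diff_distrib fps_sub_nth mult_1_right) simp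
qed simp

lemma
  shows qq_has_prod: "(\<lambda>k. 1 - fps_X ^ Suc k :: 'a :: field fps) has_prod qq_infinity"
    and qq_infinity_nth_0: "fps_nth (qq_infinity :: 'a fps) 0 = 1"
proof -
  define P where "P = (\<lambda>M. \<Prod>k<M. 1 - fps_X ^ Suc k :: 'a fps)"
  define L where "L = Abs_fps (\<lambda>n. fps_nth (P n) n)"
  have "P \<longlonglongrightarrow> L"
    unfolding tendsto_fps_iff
  proof
    fix n
    show "\<forall>\<^sub>F M in sequentially. fps_nth (P M) n = fps_nth L n"
      using eventually_ge_at_top[of n]
    proof eventually_elim
      case (elim M)
      thus ?case using qq_partial_nth[of n n M] by (simp add: L_def P_def)
    qed
  qed
  hence "(\<lambda>M. P (Suc M)) \<longlonglongrightarrow> L" by (rule LIMSEQ_Suc)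
  moreover have L0: "fps_nth L 0 = 1" by (simp add: L_def P_def)
  moreover from L0 have "L \<noteq> 0" by auto
  ultimately have *: "(\<lambda>k. 1 - fps_X ^ Suc k :: 'a fps) has_prod L"
    by (simp add: has_prod_def raw_has_prod_def P_def lessThan_Suc_atMost)
  hence "L = qq_infinity" unfolding qq_infinity_def by (rule has_prod_unique)
  with * L0 show "(\<lambda>k. 1 - fps_X ^ Suc k :: 'a fps) has_prod qq_infinity"
    and "fps_nth (qq_infinity :: 'a fps) 0 = 1" by simp_all
qed

lemma summable_mex_series:
  assumes "a > 0"
  shows "summable (\<lambda>n. (-1) ^ n * fps_X ^ (A * n * (n + 1) div 2 + a * (n + 1)) :: 'a :: field fps)"
proof -
  define f where "f = (\<lambda>n. (-1) ^ n * fps_X ^ (A * n * (n + 1) div 2 + a * (n + 1)) :: 'a fps)"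
  have nth: "fps_nth (f i) n = 0" if "n \<le> i" for n i
  proof -
    have "Suc i \<le> a * (i + 1)" using mult_right_mono[of 1 a "i + 1"] assms by simp
    hence "n < A * i * (i + 1) div 2 + a * (i + 1)" using that
      by (meson le_imp_less_Suc less_le_trans trans_le_add2)
    thus ?thesis by (simp only: f_def fps_X_power_mult_right_nth if_True)
  qed
  have "(\<lambda>N. \<Sum>i<N. f i) \<longlonglongrightarrow> Abs_fps (\<lambda>n. \<Sum>i<n. fps_nth (f i) n)"
    unfolding tendsto_fps_iff
  proof
    fix n
    show "\<forall>\<^sub>F N in sequentially. fps_nth (\<Sum>i<N. f i) n
            = fps_nth (Abs_fps (\<lambda>n. \<Sum>i<n. fps_nth (f i) n)) n"
      using eventually_ge_at_top[of n]
    proof eventually_elim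
      case (elim N)
      have "(\<Sum>i<N. fps_nth (f i) n) = (\<Sum>i<n. fps_nth (f i) n)"
        by (rule sum.mono_neutral_right) (use elim nth in auto)
      thus ?case by (simp add: fps_sum_nth)
    qed
  qed
  thus ?thesis unfolding f_def summable_def sums_def by blast
qed

end

theory Submission
  imports Defs
begin

text \<open>
  Write \<open>T i = {a, a + A, \<dots>, a + i A}\<close>. If the minimal excludant of a partition is \<open>a + j A\<close>, then
  the partition contains \<open>T i\<close> exactly for \<open>i < j\<close>, so summing \<open>(-1)^i\<close> over these \<open>i\<close> gives the
  indicator of \<open>j\<close> being odd, which is the congruence condition. Summing over all partitions of \<open>n\<close>
  and removing \<open>T i\<close> from those that contain it yields the \<open>i\<close>-th term of the series times the
  generating function of all partitions, which by Euler is the inverse of $(q;q)_\infty$.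
\<close>

section \<open>Coefficients of products and limits of formal power series\<close>

lemma fps_nth_mult_cong:
  fixes f g f' g' :: "'a :: semiring_0 fps"
  assumes "\<And>i. i \<le> n \<Longrightarrow> fps_nth f i = fps_nth f' i"
    and "\<And>i. i \<le> n \<Longrightarrow> fps_nth g i = fps_nth g' i"
  shows "fps_nth (f * g) n = fps_nth (f' * g') n"
  by (simp add: fps_mult_nth assms)

text \<open>Convergence of formal power series makes each coefficient eventually equal to that of
  the limit, so the stable value must be the limiting one.\<close>

lemma fps_nth_LIMSEQ_stable:
  assumes "S \<longlonglongrightarrow> L"
    and stable: "\<And>M. N \<le> M \<Longrightarrow> fps_nth (S M) n = fps_nth (S N) n"
  shows "fps_nth L n = fps_nth (S N) n"
proof -
  have "\<forall>\<^sub>F M in sequentially. fps_nth (S M) n = fps_nth L n"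
    using assms(1) by (simp add: tendsto_fps_iff)
  hence "\<forall>\<^sub>F M in sequentially. M \<ge> N \<and> fps_nth (S M) n = fps_nth L n"
    by (intro eventually_conj eventually_ge_at_top)
  then obtain M where "M \<ge> N" "fps_nth (S M) n = fps_nth L n"
    using eventually_happens' sequentially_bot by blast
  with stable show ?thesis by metis
qed

lemma fps_nth_suminf_stable:
  fixes f :: "nat \<Rightarrow> 'a :: comm_ring_1 fps"
  assumes "summable f" and zero: "\<And>i. N \<le> i \<Longrightarrow> fps_nth (f i) n = 0"
  shows "fps_nth (\<Sum>i. f i) n = fps_nth (\<Sum>i<N. f i) n"
proof (rule fps_nth_LIMSEQ_stable)
  show "(\<lambda>N. \<Sum>i<N. f i) \<longlonglongrightarrow> (\<Sum>i. f i)"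
    using assms(1) by (rule summable_LIMSEQ)
  show "fps_nth (\<Sum>i<M. f i) n = fps_nth (\<Sum>i<N. f i) n" if "N \<le> M" for M
    unfolding fps_sum_nth by (rule sum.mono_neutral_right) (use that zero in auto)
qed

lemma qq_infinity_nth:
  assumes "n \<le> N"
  shows "fps_nth (qq_infinity :: 'a :: field fps) n = fps_nth (\<Prod>k<N. 1 - fps_X ^ Suc k) n"
proof (rule fps_nth_LIMSEQ_stable)
  let ?f = "\<lambda>k. 1 - fps_X ^ Suc k :: 'a fps"
  have "raw_has_prod ?f 0 qq_infinity"
  proof -
    \<comment> \<open>\<open>has_prod\<close> also allows the value 0 when some factor vanishes; the
      constant coefficient 1 of every factor excludes that case.\<close>
    have "?f k \<noteq> 0" for k
    proof
      assume "?f k = 0"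
      hence "fps_nth (?f k) 0 = 0" by simp
      thus False by simp
    qed
    thus ?thesis
      using qq_has_prod[where ?'a = 'a] unfolding has_prod_def by metis
  qed
  hence "(\<lambda>N. \<Prod>k\<le>N. ?f k) \<longlonglongrightarrow> qq_infinity"
    by (simp add: raw_has_prod_def)
  hence "(\<lambda>N. \<Prod>k<Suc N. ?f k) \<longlonglongrightarrow> qq_infinity"
    by (simp only: lessThan_Suc_atMost)
  thus "(\<lambda>N. \<Prod>k<N. ?f k) \<longlonglongrightarrow> qq_infinity"
    by (rule LIMSEQ_imp_Suc)
qed (use assms qq_partial_nth in blast)

section \<open>Generating functions of partitions with parts in a given set\<close>

lemma member_le_sum_mset:
  fixes k :: nat
  assumes "k \<in># \<pi>"
  shows "k \<le> sum_mset \<pi>"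
  by (simp add: sum_mset.remove[OF assms])

text \<open>The set of allowed parts is a parameter so that Euler's product can be built up one part
  at a time. If 0 is in \<open>S\<close>, a nonempty set of this form is infinite and its
  \<open>card\<close> is 0.\<close>

definition partitions_in :: "nat set \<Rightarrow> nat \<Rightarrow> nat multiset set" where
  "partitions_in S n = {\<pi>. set_mset \<pi> \<subseteq> S \<and> sum_mset \<pi> = n}"

definition partition_gf :: "nat set \<Rightarrow> 'a :: semiring_1 fps" where
  "partition_gf S = Abs_fps (\<lambda>n. of_nat (card (partitions_in S n)))"

lemma partitions_in_pos: "partitions_in {0<..} n = {\<pi>. is_partition n \<pi>}"
  by (auto simp: partitions_in_def is_partition_def)

lemma finite_partitions_in:
  assumes "0 \<notin> S"
  shows "finite (partitions_in S n)"
proof (rule finite_subset[OF _ finite_partitions[of n]])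
  show "partitions_in S n \<subseteq> {\<pi>. is_partition n \<pi>}"
    using assms by (auto simp: partitions_in_def is_partition_def intro!: gr0I)
qed

text \<open>Adding \<open>T\<close> is a bijection onto the multisets containing \<open>T\<close>,
  with inverse subtraction of \<open>T\<close>. It is used for a single part \<open>k\<close> in
  Euler's product and for a progression in the final series.\<close>

lemma partition_gf_supset:
  assumes "set_mset T \<subseteq> S"
  shows "Abs_fps (\<lambda>n. of_nat (card {\<pi> \<in> partitions_in S n. T \<subseteq># \<pi>})) =
    fps_X ^ sum_mset T * (partition_gf S :: 'a :: comm_ring_1 fps)"
proof (rule fps_ext)
  fix n
  let ?B = "{\<pi> \<in> partitions_in S n. T \<subseteq># \<pi>}"
  have sum_le: "sum_mset T \<le> n" if "\<pi> \<in> ?B" for \<pi>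
    using that by (auto simp: partitions_in_def subset_mset.le_iff_add)
  have "card ?B = card (partitions_in S (n - sum_mset T))" if "sum_mset T \<le> n"
  proof (rule sym, rule bij_betw_same_card)
    show "bij_betw (\<lambda>\<pi>. T + \<pi>) (partitions_in S (n - sum_mset T)) ?B"
      by (rule bij_betwI[where g = "\<lambda>\<pi>. \<pi> - T"])
        (use that assms in \<open>auto simp: partitions_in_def sum_mset_diff dest: in_diffD\<close>)
  qed
  moreover have "?B = {}" if "\<not> sum_mset T \<le> n"
    using that sum_le by blast
  ultimately show "fps_nth (Abs_fps (\<lambda>n. of_nat (card {\<pi> \<in> partitions_in S n. T \<subseteq># \<pi>}))) n =
    fps_nth (fps_X ^ sum_mset T * (partition_gf S :: 'a fps)) n"
    by (auto simp: fps_X_power_mult_nth partition_gf_def simp del: Collect_empty_eq)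
qed

text \<open>Partitions split into those avoiding \<open>k\<close> and those containing it; the
  latter contribute \<open>fps_X ^ k * partition_gf S\<close>.\<close>

lemma partition_gf_remove:
  assumes "0 \<notin> S" "k \<in> S"
  shows "(1 - fps_X ^ k) * partition_gf S = (partition_gf (S - {k}) :: 'a :: comm_ring_1 fps)"
proof -
  have "partition_gf S = (partition_gf (S - {k}) :: 'a fps) +
    Abs_fps (\<lambda>n. of_nat (card {\<pi> \<in> partitions_in S n. {#k#} \<subseteq># \<pi>}))"
  proof (rule fps_ext)
    fix n
    have "partitions_in S n =
      partitions_in (S - {k}) n \<union> {\<pi> \<in> partitions_in S n. {#k#} \<subseteq># \<pi>}"
      by (auto simp: partitions_in_def)
    moreover have "partitions_in (S - {k}) n \<inter> {\<pi> \<in> partitions_in S n. {#k#} \<subseteq># \<pi>} = {}"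
      by (auto simp: partitions_in_def)
    ultimately have "card (partitions_in S n) =
      card (partitions_in (S - {k}) n) + card {\<pi> \<in> partitions_in S n. {#k#} \<subseteq># \<pi>}"
      using finite_partitions_in[OF assms(1), of n]
      by (metis (no_types, lifting) card_Un_disjoint finite_Un)
    thus "fps_nth (partition_gf S) n = fps_nth ((partition_gf (S - {k}) :: 'a fps) +
      Abs_fps (\<lambda>n. of_nat (card {\<pi> \<in> partitions_in S n. {#k#} \<subseteq># \<pi>}))) n"
      by (simp add: partition_gf_def)
  qed
  also have "Abs_fps (\<lambda>n. of_nat (card {\<pi> \<in> partitions_in S n. {#k#} \<subseteq># \<pi>})) =
    fps_X ^ k * (partition_gf S :: 'a fps)"
    using partition_gf_supset[of "{#k#}" S] assms by simp
  finally show ?thesis by (simp add: algebra_simps)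
qed

text \<open>Each factor removes the largest allowed part, until only the empty partition is
  left.\<close>

lemma prod_mult_partition_gf:
  "(\<Prod>k<N. 1 - fps_X ^ Suc k) * partition_gf {0<..N} = (1 :: 'a :: comm_ring_1 fps)"
proof (induction N)
  case 0
  have "partitions_in {} n = (if n = 0 then {{#}} else {})" for n
    by (auto simp: partitions_in_def)
  thus ?case by (auto simp: fps_eq_iff partition_gf_def)
next
  case (Suc N)
  have "{0<..Suc N} - {Suc N} = {0<..N}" by auto
  thus ?case
    using Suc.IH partition_gf_remove[of "{0<..Suc N}" "Suc N", where ?'a = 'a]
    by (simp add: mult.assoc del: power_Suc)
qed

text \<open>Coefficients up to \<open>n\<close> see only parts of size at most \<open>n\<close> and
  the first \<open>n\<close> factors, so the finite identity suffices.\<close>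

lemma qq_infinity_mult_partition_gf:
  "qq_infinity * partition_gf {0<..} = (1 :: 'a :: field fps)"
proof (rule fps_ext)
  fix n
  have "partitions_in {0<..} i = partitions_in {0<..n} i" if "i \<le> n" for i
    using that member_le_sum_mset le_trans by (fastforce simp: partitions_in_def)
  hence "fps_nth (qq_infinity * partition_gf {0<..} :: 'a fps) n =
    fps_nth ((\<Prod>k<n. 1 - fps_X ^ Suc k) * partition_gf {0<..n}) n"
    by (intro fps_nth_mult_cong) (simp_all add: qq_infinity_nth partition_gf_def del: power_Suc)
  thus "fps_nth (qq_infinity * partition_gf {0<..} :: 'a fps) n = fps_nth 1 n"
    by (simp only: prod_mult_partition_gf)
qed

section \<open>The minimal excludant through its position in the progression\<close>

definition mex_index :: "nat \<Rightarrow> nat \<Rightarrow> nat multiset \<Rightarrow> nat" where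
  "mex_index A a \<pi> = (LEAST j. a + A * j \<notin># \<pi>)"

lemma mex_index_notin:
  assumes "A > 0"
  shows "a + A * mex_index A a \<pi> \<notin># \<pi>"
proof -
  obtain j where "a + A * j \<notin># \<pi>"
    using mex_exists[OF assms, of a \<pi>] by blast
  thus ?thesis unfolding mex_index_def by (rule LeastI)
qed

lemma less_mex_indexD: "j < mex_index A a \<pi> \<Longrightarrow> a + A * j \<in># \<pi>"
  unfolding mex_index_def using not_less_Least by blast

lemma mex_eq_mex_index:
  assumes "A > 0"
  shows "mex A a \<pi> = a + A * mex_index A a \<pi>"
  unfolding mex_def
proof (rule Least_equality)
  fix m assume "m \<in> {a + A * j | j. True} \<and> m \<notin># \<pi>"
  then obtain j where m: "m = a + A * j" and "a + A * j \<notin># \<pi>" by blast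
  hence "mex_index A a \<pi> \<le> j"
    using less_mex_indexD not_le by blast
  thus "a + A * mex_index A a \<pi> \<le> m" by (simp add: m)
qed (use mex_index_notin[OF assms] in auto)

lemma mex_cong_iff:
  assumes "A > 0"
  shows "[mex A a \<pi> = A + a] (mod (2 * A)) \<longleftrightarrow> odd (mex_index A a \<pi>)"
proof -
  have "[mex A a \<pi> = A + a] (mod (2 * A)) \<longleftrightarrow> [A * mex_index A a \<pi> = A * 1] (mod (A * 2))"
    by (simp add: mex_eq_mex_index[OF assms] add.commute[of A a] mult.commute cong_add_lcancel_nat)
  also have "\<dots> \<longleftrightarrow> odd (mex_index A a \<pi>)"
    using assms by (simp only: cong_def mult_mod_right[symmetric]) (auto simp: odd_iff_mod_2_eq_one)
  finally show ?thesis .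
qed

text \<open>The part just before the excludant is at least \<open>mex_index A a \<pi>\<close>. This
  gives one summation range for all partitions of \<open>n\<close>.\<close>

lemma mex_index_le:
  assumes "A > 0" "a > 0"
  shows "mex_index A a \<pi> \<le> sum_mset \<pi>"
proof (cases "mex_index A a \<pi>")
  case (Suc j)
  hence "a + A * j \<in># \<pi>" by (simp add: less_mex_indexD)
  hence "a + A * j \<le> sum_mset \<pi>" by (rule member_le_sum_mset)
  moreover have "Suc j \<le> a + A * j"
    using add_mono[of 1 a j "A * j"] assms by simp
  ultimately show ?thesis using Suc by simp
qed simp

text \<open>Every element has multiplicity one, so containment as a multiset only asks that each
  element occur as a part.\<close>

definition progression :: "nat \<Rightarrow> nat \<Rightarrow> nat \<Rightarrow> nat multiset" where
  "progression A a i = mset_set ((\<lambda>j. a + A * j) ` {..i})"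

lemma progression_subset_iff:
  assumes "A > 0"
  shows "progression A a i \<subseteq># \<pi> \<longleftrightarrow> i < mex_index A a \<pi>"
proof -
  have "progression A a i \<subseteq># \<pi> \<longleftrightarrow> (\<forall>j\<le>i. a + A * j \<in># \<pi>)"
    by (auto simp: progression_def subseteq_mset_def count_mset_set' Suc_le_eq)
  also have "\<dots> \<longleftrightarrow> i < mex_index A a \<pi>"
    using less_mex_indexD mex_index_notin[OF assms] le_less_trans not_le by blast
  finally show ?thesis .
qed

lemma sum_progression:
  assumes "A > 0"
  shows "sum_mset (progression A a i) = A * i * (i + 1) div 2 + a * (i + 1)"
proof -
  have inj: "inj_on (\<lambda>j. a + A * j) {..i}"
    using assms by (auto simp: inj_on_def)
  have "sum_mset (progression A a i) = (\<Sum>j\<le>i. a + A * j)"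
    using sum.reindex[OF inj, of "\<lambda>x. x"] by (simp add: progression_def sum_unfold_sum_mset)
  also have "\<dots> = A * i * (i + 1) div 2 + a * (i + 1)"
  proof (induction i)
    case (Suc i)
    \<comment> \<open>The increment is visibly even, so \<open>div 2\<close> adds exactly
      \<open>A * Suc i\<close>.\<close>
    have "A * Suc i * (Suc i + 1) = A * i * (i + 1) + A * Suc i * 2"
      by (simp add: algebra_simps)
    with Suc show ?case by simp
  qed simp
  finally show ?thesis .
qed

section \<open>The alternating count and the resulting series\<close>

lemma sum_alternating: "(\<Sum>i<j. (-1) ^ i) = (of_bool (odd j) :: 'a :: ring_1)"
  by (induction j) auto

text \<open>The parity indicator of each partition is expanded as an alternating sum, and the two
  summations are exchanged.\<close>

lemma p_bar_eq_sum:
  assumes "A > 0" "a > 0"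
  shows "(of_nat (p_bar A a n) :: 'a :: ring_1) = (\<Sum>i<n. (-1) ^ i *
    of_nat (card {\<pi> \<in> partitions_in {0<..} n. progression A a i \<subseteq># \<pi>}))"
proof -
  let ?P = "partitions_in {0<..} n"
  have fin: "finite ?P" by (rule finite_partitions_in) simp
  have card_eq: "of_nat (card {\<pi> \<in> ?P. Q \<pi>}) = (\<Sum>\<pi>\<in>?P. of_bool (Q \<pi>) :: 'a)" for Q
    using fin by (simp add: Collect_conj_eq flip: Int_def)
  have alt: "(\<Sum>i<n. (-1) ^ i * of_bool (progression A a i \<subseteq># \<pi>)) =
    (of_bool (odd (mex_index A a \<pi>)) :: 'a)" if "\<pi> \<in> ?P" for \<pi>
  proof -
    have "mex_index A a \<pi> \<le> n"
      using mex_index_le[OF assms, of \<pi>] that by (simp add: partitions_in_def)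
    hence "(\<Sum>i<n. (-1) ^ i * of_bool (i < mex_index A a \<pi>)) =
      (\<Sum>i<mex_index A a \<pi>. (-1) ^ i :: 'a)"
      by (intro sum.mono_neutral_cong_right) auto
    thus ?thesis by (simp add: sum_alternating progression_subset_iff[OF assms(1)])
  qed
  have "p_bar A a n = card {\<pi> \<in> ?P. odd (mex_index A a \<pi>)}"
    by (simp add: p_bar_def partitions_in_pos mex_cong_iff[OF assms(1)])
  hence "of_nat (p_bar A a n) =
    (\<Sum>\<pi>\<in>?P. \<Sum>i<n. (-1) ^ i * of_bool (progression A a i \<subseteq># \<pi>) :: 'a)"
    using alt by (simp add: card_eq)
  also have "\<dots> = (\<Sum>i<n. (-1) ^ i * (\<Sum>\<pi>\<in>?P. of_bool (progression A a i \<subseteq># \<pi>)))"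
    by (subst sum.swap) (simp only: sum_distrib_left)
  finally show ?thesis by (simp only: card_eq)
qed

theorem theorem4p2:
  fixes A a :: nat
  assumes "A > 0" and "a > 0"
  shows "Abs_fps (\<lambda>n. of_nat (p_bar A a n)) =
    (1 / qq_infinity :: 'a :: field_char_0 fps) *
    (\<Sum>n. (-1) ^ n * fps_X ^ (A * n * (n + 1) div 2 + a * (n + 1)))"
proof -
  define e where "e = (\<lambda>i. A * i * (i + 1) div 2 + a * (i + 1))"
  define f where "f = (\<lambda>i. (-1) ^ i * fps_X ^ e i :: 'a fps)"
  let ?G = "partition_gf {0<..} :: 'a fps"
  \<comment> \<open>This bound kills coefficient \<open>n\<close> of every term with
    \<open>i \<ge> n\<close>, so the series may be cut off at \<open>n\<close>, matching the range
    in \<open>p_bar_eq_sum\<close>.\<close>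
  have less_e: "i < e i" for i
    using assms mult_le_mono1[of 1 a "i + 1"] by (simp add: e_def)
  \<comment> \<open>As a constant series, the sign passes through coefficient extraction as a
    scalar.\<close>
  have minus_one: "(-1) ^ i = fps_const ((-1) ^ i :: 'a)" for i
    by (induction i) (auto simp flip: fps_const_neg)
  have summable: "summable f"
    unfolding f_def e_def using assms(2) by (rule summable_mex_series)
  have f_nth: "fps_nth (f i) k = 0" if "k \<le> i" for i k
    using that less_e[of i] by (simp add: f_def minus_one)
  have inv: "1 / qq_infinity = ?G"
  proof -
    have "inverse qq_infinity = ?G"
      using fps_inverse_unique[OF qq_infinity_mult_partition_gf] .
    thus ?thesis
      using qq_infinity_nth_0[where ?'a = 'a] by (simp add: fps_divide_unit)
  qed
  have "Abs_fps (\<lambda>n. of_nat (p_bar A a n)) = ?G * (\<Sum>i. f i)"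
  proof (rule fps_ext)
    fix n
    have "of_nat (card {\<pi> \<in> partitions_in {0<..} n. progression A a i \<subseteq># \<pi>}) =
      fps_nth (fps_X ^ e i * ?G) n" for i
    proof -
      have "set_mset (progression A a i) \<subseteq> {0<..}"
        using assms(2) by (auto simp: progression_def)
      from partition_gf_supset[OF this, where ?'a = 'a] show ?thesis
        unfolding sum_progression[OF assms(1)] e_def fps_eq_iff fps_nth_Abs_fps by blast
    qed
    hence "of_nat (p_bar A a n) = (\<Sum>i<n. fps_nth (f i * ?G) n)"
      by (simp add: p_bar_eq_sum[OF assms] f_def minus_one mult.assoc)
    also have "\<dots> = fps_nth (?G * (\<Sum>i<n. f i)) n"
      by (simp add: fps_sum_nth sum_distrib_right mult.commute[of ?G])
    \<comment> \<open>Coefficient \<open>n\<close> of the product uses only coefficients up to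
      \<open>n\<close> of the series, and these agree with those of its \<open>n\<close>-th partial
      sum.\<close>
    also have "\<dots> = fps_nth (?G * (\<Sum>i. f i)) n"
      using f_nth by (intro fps_nth_mult_cong fps_nth_suminf_stable[symmetric] summable refl) auto
    finally show "fps_nth (Abs_fps (\<lambda>n. of_nat (p_bar A a n))) n = fps_nth (?G * (\<Sum>i. f i)) n"
      by simp
  qed
  thus ?thesis unfolding inv f_def e_def .
qed

end
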